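(* Let $K$ be a field, let $c\ge1$ and let $n_1\ge n_2\ge\cdots\ge n_c\ge1$ be integers, and let $H=H(n_1,\ldots,n_c)$. The semigroup algebra $K[H]$ is normal if and only if $H$ does not dominate $H(2,2)$.
   Context: Let $e_1,\ldots,e_c$ be the standard basis of $\mathbb Z^c$. The matrix $A_{H(n_1,\ldots,n_c)}$ has $c+1$ rows and $n_1+\cdots+n_c$ columns, namely the vectors $(1,i\,e_j)\in\mathbb Z\times\mathbb Z^c$ for $1\le j\le c$, $1\le i\le n_j$. $K[H]=K[H(n_1,\ldots,n_c)]$ denotes the semigroup algebra over $K$ of the subsemigroup of $\mathbb Z^{c+1}$ (with $0$) generated by the columns of $A_{H(n_1,\ldots,n_c)}$; equivalently, the quotient of the polynomial ring over $K$ by the toric ideal of $A_{H(n_1,\ldots,n_c)}$. Normal means integrally closed in its field of fractions. Dominance: $H(b_1,\ldots,b_d)$ dominates $H(a_1,\ldots,a_c)$ if $c\le d$ and $a_j\le b_j$ for $j=1,\ldots,c$ (sequences weakly decreasing). *)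

theory Defs
  imports
    "HOL-Library.Poly_Mapping"
    "HOL-Computational_Algebra.Polynomial"
    "HOL-Computational_Algebra.Fraction_Field"
begin

text \<open>
  The sequence \<open>(n\<^sub>1, \<dots>, n\<^sub>c)\<close> is the list \<open>ns\<close> of length \<open>c\<close>; list positions start at 0, so
  \<open>n\<^sub>j\<close> is \<open>ns ! (j - 1)\<close>. The lattice \<open>\<int> \<times> \<int>\<^sup>c\<close> is the set of all \<open>v :: nat \<Rightarrow>\<^sub>0 int\<close> supported
  in \<open>{0..c}\<close>: coordinate 0 is the leading \<open>\<int>\<close>, coordinate \<open>j\<close> is the \<open>j\<close>-th coordinate of \<open>\<int>\<^sup>c\<close>.
\<close>

definition H_columns :: "nat list \<Rightarrow> (nat \<Rightarrow>\<^sub>0 int) set" where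
  "H_columns ns =
     {Poly_Mapping.single 0 1 + Poly_Mapping.single j (int i) | j i.
        1 \<le> j \<and> j \<le> length ns \<and> 1 \<le> i \<and> i \<le> ns ! (j - 1)}"

definition H_dominates :: "nat list \<Rightarrow> nat list \<Rightarrow> bool" where
  "H_dominates bs as \<longleftrightarrow> length as \<le> length bs \<and> (\<forall>j<length as. as ! j \<le> bs ! j)"

inductive_set generated_monoid :: "'a::monoid_add set \<Rightarrow> 'a set" for G where
  zero: "0 \<in> generated_monoid G"
| base: "g \<in> G \<Longrightarrow> g \<in> generated_monoid G"
| add: "x \<in> generated_monoid G \<Longrightarrow> y \<in> generated_monoid G \<Longrightarrow> x + y \<in> generated_monoid G"

text \<open>
  \<open>'m \<Rightarrow>\<^sub>0 'k\<close> with the convolution product of \<^theory>\<open>HOL-Library.Poly_Mapping\<close> is the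
  monoid algebra of \<open>'m\<close> over \<open>'k\<close>. The semigroup algebra of a submonoid \<open>S\<close> is the subring of
  elements supported in \<open>S\<close>.
\<close>

definition semigroup_algebra :: "'m::comm_monoid_add set \<Rightarrow> ('m \<Rightarrow>\<^sub>0 'k::field) set" where
  "semigroup_algebra S = {f. Poly_Mapping.keys f \<subseteq> S}"

lemma semigroup_algebra_closed:
  fixes G :: "'m::comm_monoid_add set"
  defines "A \<equiv> (semigroup_algebra (generated_monoid G) :: ('m \<Rightarrow>\<^sub>0 'k::field) set)"
  shows "0 \<in> A" and "1 \<in> A"
    and "f \<in> A \<Longrightarrow> g \<in> A \<Longrightarrow> f + g \<in> A"
    and "f \<in> A \<Longrightarrow> - f \<in> A"
    and "f \<in> A \<Longrightarrow> g \<in> A \<Longrightarrow> f * g \<in> A"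
proof -
  show "0 \<in> A" "1 \<in> A"
    unfolding A_def semigroup_algebra_def by (auto intro: generated_monoid.zero)
  show "f + g \<in> A" if "f \<in> A" "g \<in> A"
    using that keys_add[of f g] unfolding A_def semigroup_algebra_def by blast
  show "- f \<in> A" if "f \<in> A"
    using that unfolding A_def semigroup_algebra_def by simp
  show "f * g \<in> A" if "f \<in> A" "g \<in> A"
    using that keys_mult[of f g] unfolding A_def semigroup_algebra_def
    by (fastforce intro: generated_monoid.add)
qed

definition integral_over :: "'a::comm_ring_1 set \<Rightarrow> 'a \<Rightarrow> bool" where
  "integral_over B x \<longleftrightarrow>
     (\<exists>p. lead_coeff p = 1 \<and> (\<forall>i. coeff p i \<in> B) \<and> poly p x = 0)"

text \<open>
  A subring \<open>A\<close> of an integral domain \<open>'a\<close> is embedded in \<open>'a fract\<close> by \<open>a \<mapsto> a/1\<close>; its field of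
  fractions is the subfield of quotients with numerator and denominator in \<open>A\<close>, which in
  general is smaller than \<open>'a fract\<close>.
\<close>

definition fraction_embedding :: "'a::idom set \<Rightarrow> 'a fract set" where
  "fraction_embedding A = {Fract a 1 | a. a \<in> A}"

definition field_of_fractions :: "'a::idom set \<Rightarrow> 'a fract set" where
  "field_of_fractions A = {Fract a b | a b. a \<in> A \<and> b \<in> A \<and> b \<noteq> 0}"

definition normal_subring :: "'a::idom set \<Rightarrow> bool" where
  "normal_subring A \<longleftrightarrow>
     (\<forall>x \<in> field_of_fractions A.
        integral_over (fraction_embedding A) x \<longrightarrow> x \<in> fraction_embedding A)"

definition H_algebra :: "nat list \<Rightarrow> ((nat \<Rightarrow>\<^sub>0 int) \<Rightarrow>\<^sub>0 'k::field) set" where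
  "H_algebra ns = semigroup_algebra (generated_monoid (H_columns ns))"

end

theory Submission
  imports Defs
begin

text \<open>
  Normality of \<open>K[S]\<close> is saturation of the semigroup \<open>S\<close>. If \<open>n\<^sub>1, n\<^sub>2 \<ge> 2\<close>, the vector
  \<open>v = (1, e\<^sub>1 + e\<^sub>2)\<close> is a difference of two elements of \<open>S\<close> and
  \<open>2v = (1, 2e\<^sub>1) + (1, 2e\<^sub>2)\<close> lies in \<open>S\<close>, but \<open>v\<close> itself does not, since the elements of \<open>S\<close> with
  first coordinate 1 are the columns. Hence \<open>X\<^sup>v\<close> is a quotient of elements of \<open>K[S]\<close>, is a
  root of \<open>T\<^sup>2 - X\<^bsup>2v\<^esup>\<close>, and is not in \<open>K[S]\<close> (\<open>not_normal_if_not_saturated\<close>).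

  If \<open>n\<^sub>2 = \<dots> = n\<^sub>c = 1\<close>, put \<open>p = v\<^sub>0 - (v\<^sub>2 + \<dots> + v\<^sub>c)\<close>. Then \<open>S\<close> is the set of all lattice points
  with \<open>v\<^sub>j \<ge> 0\<close> for \<open>j \<ge> 2\<close> and \<open>0 \<le> p \<le> v\<^sub>1 \<le> n\<^sub>1 p\<close> (\<open>generated_monoid_eq_cone\<close>): the \<open>v\<^sub>j\<close> count the
  columns of the blocks \<open>j \<ge> 2\<close>, and \<open>v\<^sub>1\<close> is a sum of \<open>p\<close> numbers in \<open>{1..n\<^sub>1}\<close>. It remains to see that
  linear inequalities define normal semigroup algebras (\<open>normal_of_inequalities\<close>).

  For this, let \<open>x = a/b\<close> be integral over \<open>K[S]\<close>. All powers of \<open>x\<close> then have a common denominator \<open>d\<close>,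
  that is, \<open>d x\<^sup>k \<in> K[S]\<close> for all \<open>k\<close>. The Laurent polynomial ring of the whole lattice is completely
  integrally closed, so \<open>x\<close> is a Laurent polynomial. Were some functional \<open>l\<close> that is nonnegative
  on \<open>S\<close> negative on the support of \<open>x\<close>, the least value of \<open>l\<close> on the support of \<open>d x\<^sup>k\<close> would tend to
  \<open>-\<infinity>\<close> with \<open>k\<close>, which contradicts \<open>d x\<^sup>k \<in> K[S]\<close>.

  Complete integral closedness of Laurent polynomial rings is proved one variable at a time
  (\<open>completely_integrally_closed_extend\<close>), by polynomial division: the hypothesis on \<open>d\<close> passes to
  leading coefficients, so the coefficient ring supplies each step of the division of \<open>a\<close> by \<open>b\<close>,
  and a remainder of smaller degree must vanish because the degrees of \<open>d x\<^sup>k\<close> would tend to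
  \<open>-\<infinity>\<close> while its order stays bounded below. Working with common denominators rather than with
  integral equations is what makes the passage to leading coefficients possible.
\<close>

abbreviation "keys \<equiv> Poly_Mapping.keys"
abbreviation "lookup \<equiv> Poly_Mapping.lookup"

section \<open>Subrings and almost integral quotients\<close>

locale closed_subring =
  fixes A :: "'a::idom set"
  assumes zero_mem: "0 \<in> A" and one_mem: "1 \<in> A"
    and add_mem: "\<And>f g. f \<in> A \<Longrightarrow> g \<in> A \<Longrightarrow> f + g \<in> A"
    and uminus_mem: "\<And>f. f \<in> A \<Longrightarrow> - f \<in> A"
    and mult_mem: "\<And>f g. f \<in> A \<Longrightarrow> g \<in> A \<Longrightarrow> f * g \<in> A"
begin

lemma diff_mem: "f \<in> A \<Longrightarrow> g \<in> A \<Longrightarrow> f - g \<in> A"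
  using add_mem[of f "- g"] uminus_mem[of g] by simp

lemma power_mem: "f \<in> A \<Longrightarrow> f ^ k \<in> A"
  by (induction k) (auto intro: one_mem mult_mem)

lemma sum_mem: "(\<And>i. i \<in> I \<Longrightarrow> f i \<in> A) \<Longrightarrow> sum f I \<in> A"
  by (induction I rule: infinite_finite_induct) (auto intro: zero_mem add_mem)

lemma fraction_embedding_closed: "closed_subring (fraction_embedding A)"
proof
  show "0 \<in> fraction_embedding A"
    unfolding fraction_embedding_def Zero_fract_def using zero_mem by blast
  show "1 \<in> fraction_embedding A"
    unfolding fraction_embedding_def One_fract_def using one_mem by blast
  show "f + g \<in> fraction_embedding A"
    if "f \<in> fraction_embedding A" "g \<in> fraction_embedding A" for f g
    using that add_mem unfolding fraction_embedding_def by force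
  show "- f \<in> fraction_embedding A" if "f \<in> fraction_embedding A" for f
    using that uminus_mem unfolding fraction_embedding_def by force
  show "f * g \<in> fraction_embedding A"
    if "f \<in> fraction_embedding A" "g \<in> fraction_embedding A" for f g
    using that mult_mem unfolding fraction_embedding_def by force
qed

end

text \<open>
  With \<open>x = a/b\<close>, the element \<open>d\<close> is a common denominator of all powers of \<open>x\<close>. Clearing
  denominators keeps the condition inside the ring \<open>A\<close>, so that degrees and leading terms can be
  compared on both sides.
\<close>

definition bounded_denominator :: "'a::idom set \<Rightarrow> 'a \<Rightarrow> 'a \<Rightarrow> 'a \<Rightarrow> bool" where
  "bounded_denominator A d a b \<longleftrightarrow> (\<forall>k. \<exists>g\<in>A. d * a ^ k = b ^ k * g)"

definition completely_integrally_closed :: "'a::idom set \<Rightarrow> bool" where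
  "completely_integrally_closed A \<longleftrightarrow>
     (\<forall>a\<in>A. \<forall>b\<in>A. \<forall>d\<in>A. b \<noteq> 0 \<longrightarrow> d \<noteq> 0 \<longrightarrow> bounded_denominator A d a b \<longrightarrow>
       (\<exists>q\<in>A. a = b * q))"

lemma Fract_power: "Fract a b ^ k = Fract (a ^ k) (b ^ k)" if "b \<noteq> 0"
  by (induction k) (auto simp: One_fract_def that)

context closed_subring
begin

text \<open>
  If \<open>x = a/b\<close> is a root of a monic polynomial of degree \<open>n\<close>, then \<open>b\<^sup>n\<close> clears the denominators of
  \<open>1, x, \<dots>, x\<^bsup>n-1\<^esup>\<close>, and every higher power of \<open>x\<close> is an \<open>A\<close>-combination of these.
\<close>

lemma integral_imp_bounded_denominator:
  assumes "a \<in> A" "b \<in> A" "b \<noteq> 0"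
    and "integral_over (fraction_embedding A) (Fract a b)"
  obtains d where "d \<in> A" "d \<noteq> 0" "bounded_denominator A d a b"
proof -
  define E where "E = fraction_embedding A"
  interpret E: closed_subring E
    unfolding E_def by (rule fraction_embedding_closed)
  define x where "x = Fract a b"
  obtain p where p: "lead_coeff p = 1" "\<And>i. coeff p i \<in> E" "poly p x = 0"
    using assms(4) unfolding integral_over_def E_def x_def by blast
  define n where "n = degree p"
  define D where "D = Fract (b ^ n) 1"
  have top: "x ^ n = - (\<Sum>i<n. coeff p i * x ^ i)"
  proof -
    have "0 = (\<Sum>i\<le>n. coeff p i * x ^ i)"
      using p(3) by (simp add: poly_altdef n_def)
    also have "\<dots> = (\<Sum>i<n. coeff p i * x ^ i) + x ^ n"
      using p(1) by (simp add: lessThan_Suc_atMost[symmetric] n_def)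
    finally show ?thesis
      by (simp add: eq_neg_iff_add_eq_0 add.commute)
  qed
  have power_mem_E: "D * x ^ k \<in> E" for k
  proof (induction k rule: less_induct)
    case (less k)
    show ?case
    proof (cases "k < n")
      case True
      have "D * x ^ k = Fract (b ^ k * (b ^ (n - k) * a ^ k)) (b ^ k * 1)"
        unfolding D_def x_def using True assms(3)
        by (simp add: Fract_power mult.assoc[symmetric] power_add[symmetric])
      also have "\<dots> = Fract (b ^ (n - k) * a ^ k) 1"
        using assms(3) by (subst mult_fract_cancel) auto
      also have "\<dots> \<in> E"
        unfolding E_def fraction_embedding_def
        using assms(1,2) by (auto intro!: exI mult_mem power_mem)
      finally show ?thesis .
    next
      case False
      have "D * x ^ k = D * (x ^ n * x ^ (k - n))"
        using False by (simp add: power_add[symmetric])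
      also have "\<dots> = - (\<Sum>i<n. coeff p i * (D * x ^ (i + (k - n))))"
        unfolding top by (simp add: sum_distrib_left sum_distrib_right power_add mult_ac)
      also have "\<dots> \<in> E"
        using False by (intro E.uminus_mem E.sum_mem E.mult_mem p(2) less.IH) auto
      finally show ?thesis .
    qed
  qed
  show ?thesis
  proof (rule that[of "b ^ n"])
    show "bounded_denominator A (b ^ n) a b"
      unfolding bounded_denominator_def
    proof
      fix k
      obtain g where g: "g \<in> A" "D * x ^ k = Fract g 1"
        using power_mem_E[of k] unfolding E_def fraction_embedding_def by blast
      have "Fract (b ^ n * a ^ k) (b ^ k) = Fract g 1"
        using g(2) assms(3) unfolding D_def x_def by (simp add: Fract_power)
      then have "b ^ n * a ^ k = b ^ k * g"
        using assms(3) by (simp add: eq_fract mult.commute)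
      then show "\<exists>g\<in>A. b ^ n * a ^ k = b ^ k * g"
        using g(1) by blast
    qed
  qed (use assms in \<open>auto intro: power_mem\<close>)
qed

lemma bounded_denominator_mult:
  assumes "bounded_denominator A d a b" "u \<in> A"
  shows "bounded_denominator A d (u * a) b"
  unfolding bounded_denominator_def
proof
  fix k
  obtain g where g: "g \<in> A" "d * a ^ k = b ^ k * g"
    using assms(1) unfolding bounded_denominator_def by blast
  have "d * (u * a) ^ k = u ^ k * (d * a ^ k)"
    by (simp add: power_mult_distrib mult_ac)
  also have "\<dots> = b ^ k * (u ^ k * g)"
    by (simp add: g mult_ac)
  finally show "\<exists>g\<in>A. d * (u * a) ^ k = b ^ k * g"
    using g(1) assms(2) by (auto intro: mult_mem power_mem)
qed

text \<open>
  Subtracting an element \<open>q\<close> of \<open>A\<close> from \<open>a/b\<close> keeps the same common denominator. This is what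
  allows the division algorithm to be run with a fixed \<open>d\<close>.
\<close>

lemma bounded_denominator_diff:
  assumes "bounded_denominator A d a b" "q \<in> A"
  shows "bounded_denominator A d (a - b * q) b"
proof -
  \<comment> \<open>Mixed powers of \<open>a\<close> and \<open>a - b * q\<close> make the induction work without binomial coefficients.\<close>
  have "\<exists>g\<in>A. d * a ^ j * (a - b * q) ^ k = b ^ (j + k) * g" for j k
  proof (induction k arbitrary: j)
    case 0
    then show ?case
      using assms(1) unfolding bounded_denominator_def by simp
  next
    case (Suc k)
    obtain g1 where g1: "g1 \<in> A" "d * a ^ Suc j * (a - b * q) ^ k = b ^ (Suc j + k) * g1"
      using Suc[of "Suc j"] by blast
    obtain g2 where g2: "g2 \<in> A" "d * a ^ j * (a - b * q) ^ k = b ^ (j + k) * g2"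
      using Suc[of j] by blast
    have "d * a ^ j * (a - b * q) ^ Suc k
        = d * a ^ Suc j * (a - b * q) ^ k - b * q * (d * a ^ j * (a - b * q) ^ k)"
      by (simp add: algebra_simps)
    also have "\<dots> = b ^ (j + Suc k) * (g1 - q * g2)"
      unfolding g1(2) g2(2) by (simp add: algebra_simps)
    finally show ?case
      using g1(1) g2(1) assms(2) by (blast intro: diff_mem mult_mem)
  qed
  from this[of 0] show ?thesis
    unfolding bounded_denominator_def by simp
qed

end

section \<open>Weights on a monoid algebra\<close>

text \<open>
  The degree of \<open>f\<close> in the grading by \<open>l\<close>; the value at \<open>f = 0\<close> is unspecified. The order, or least
  value of \<open>l\<close> on the support, is the negative of the weight for \<open>-l\<close>.
\<close>

definition weight :: "('m \<Rightarrow> int) \<Rightarrow> ('m \<Rightarrow>\<^sub>0 'k::zero) \<Rightarrow> int" where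
  "weight l f = Max (l ` keys f)"

definition component :: "('m \<Rightarrow> int) \<Rightarrow> int \<Rightarrow> ('m \<Rightarrow>\<^sub>0 'k::zero) \<Rightarrow> ('m \<Rightarrow>\<^sub>0 'k)" where
  "component l i f = Poly_Mapping.mapp (\<lambda>v c. c when l v = i) f"

abbreviation top_part :: "('m \<Rightarrow> int) \<Rightarrow> ('m \<Rightarrow>\<^sub>0 'k::zero) \<Rightarrow> ('m \<Rightarrow>\<^sub>0 'k)" where
  "top_part l f \<equiv> component l (weight l f) f"

lemma lookup_component: "lookup (component l i f) v = (lookup f v when l v = i)"
  by (auto simp: component_def lookup_mapp when_def in_keys_iff)

lemma keys_component: "keys (component l i f) = {v \<in> keys f. l v = i}"
  by (auto simp: in_keys_iff lookup_component)

lemma le_weight: "v \<in> keys f \<Longrightarrow> l v \<le> weight l f"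
  by (simp add: weight_def)

lemma weight_attained: "f \<noteq> 0 \<Longrightarrow> \<exists>v\<in>keys f. l v = weight l f"
proof -
  assume "f \<noteq> 0"
  then have "weight l f \<in> l ` keys f"
    unfolding weight_def by (intro Max_in) auto
  then show ?thesis
    by force
qed

lemma weight_eqI:
  assumes "v \<in> keys f" "l v = i" "\<And>u. u \<in> keys f \<Longrightarrow> l u \<le> i"
  shows "weight l f = i"
  unfolding weight_def using assms by (intro Max_eqI) auto

lemma top_part_nonzero:
  assumes "f \<noteq> 0"
  shows "top_part l f \<noteq> 0"
proof -
  have "keys (top_part l f) \<noteq> {}"
    using weight_attained[OF assms, of l] by (auto simp: keys_component)
  then show ?thesis
    by auto
qed

lemma component_add: "component l i (f + g) = component l i f + component l i g"
  by (rule poly_mapping_eqI) (simp add: lookup_component lookup_add when_add_distrib)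

lemma component_zero_if_less: 
  assumes "\<And>v. v \<in> keys f \<Longrightarrow> l v < i"
  shows "component l i f = 0"
  using assms by (intro poly_mapping_eqI) (auto simp: lookup_component when_def in_keys_iff)

lemma component_self:
  assumes "\<And>v. v \<in> keys f \<Longrightarrow> l v = i"
  shows "component l i f = f"
  using assms by (intro poly_mapping_eqI) (auto simp: lookup_component when_def in_keys_iff)

lemma keys_mult_additive:
  fixes f g :: "'m::ab_group_add \<Rightarrow>\<^sub>0 'k::semiring_0"
  assumes "Modules.additive l" "v \<in> keys (f * g)"
  obtains a b where "a \<in> keys f" "b \<in> keys g" "v = a + b" "l v = l a + l b"
  using assms(2) keys_mult[of f g] additive.add[OF assms(1)] by blast

text \<open>
  Only the two extremal components can contribute in weight \<open>i + j\<close>: every other pair of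
  exponents has a strictly smaller sum of weights.
\<close>

lemma component_mult:
  fixes f g :: "'m::ab_group_add \<Rightarrow>\<^sub>0 'k::comm_ring_1"
  assumes l: "Modules.additive l"
    and f: "\<And>v. v \<in> keys f \<Longrightarrow> l v \<le> i" and g: "\<And>v. v \<in> keys g \<Longrightarrow> l v \<le> j"
  shows "component l (i + j) (f * g) = component l i f * component l j g"
proof -
  define f0 g0 where "f0 = component l i f" and "g0 = component l j g"
  define f1 g1 where "f1 = f - f0" and "g1 = g - g0"
  have f1: "l v < i" if "v \<in> keys f1" for v
  proof -
    have "lookup f v \<noteq> 0" "l v \<noteq> i"
      using that unfolding f1_def f0_def
      by (auto simp: in_keys_iff lookup_minus lookup_component when_def split: if_splits)
    then show ?thesis
      using f[of v] by (simp add: in_keys_iff)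
  qed
  have g1: "l v < j" if "v \<in> keys g1" for v
  proof -
    have "lookup g v \<noteq> 0" "l v \<noteq> j"
      using that unfolding g1_def g0_def
      by (auto simp: in_keys_iff lookup_minus lookup_component when_def split: if_splits)
    then show ?thesis
      using g[of v] by (simp add: in_keys_iff)
  qed
  have "f * g = f0 * g0 + (f0 * g1 + f1 * g)"
    by (simp add: f1_def g1_def algebra_simps)
  moreover have "component l (i + j) (f0 * g0) = f0 * g0"
    by (rule component_self)
      (auto simp: f0_def g0_def keys_component elim!: keys_mult_additive[OF l])
  moreover have "component l (i + j) (f0 * g1) = 0"
    using g1 by (intro component_zero_if_less)
      (force simp: f0_def keys_component elim!: keys_mult_additive[OF l])
  moreover have "component l (i + j) (f1 * g) = 0"
    using f1 g by (intro component_zero_if_less)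
      (force elim!: keys_mult_additive[OF l])
  ultimately show ?thesis
    by (simp add: component_add f0_def g0_def)
qed

text \<open>
  Since the monoid algebra is a domain, the product of the top parts does not vanish, so it is the
  top part of the product.
\<close>

lemma
  fixes f g :: "'m::linordered_ab_group_add \<Rightarrow>\<^sub>0 'k::field"
  assumes l: "Modules.additive l" and "f \<noteq> 0" "g \<noteq> 0"
  shows weight_mult: "weight l (f * g) = weight l f + weight l g"
    and top_part_mult: "top_part l (f * g) = top_part l f * top_part l g"
proof -
  have eq: "component l (weight l f + weight l g) (f * g) = top_part l f * top_part l g"
    by (intro component_mult l le_weight)
  have "top_part l f * top_part l g \<noteq> 0"
    using assms by (simp add: top_part_nonzero)
  then obtain v where "v \<in> keys (component l (weight l f + weight l g) (f * g))"
    unfolding eq by (metis keys_eq_empty ex_in_conv)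
  then have v: "v \<in> keys (f * g)" "l v = weight l f + weight l g"
    by (auto simp: keys_component)
  have "l u \<le> weight l f + weight l g" if "u \<in> keys (f * g)" for u
    using that by (elim keys_mult_additive[OF l]) (simp add: add_mono le_weight)
  with v show w: "weight l (f * g) = weight l f + weight l g"
    by (intro weight_eqI)
  show "top_part l (f * g) = top_part l f * top_part l g"
    unfolding w by (rule eq)
qed

lemma
  fixes f :: "'m::linordered_ab_group_add \<Rightarrow>\<^sub>0 'k::field"
  assumes l: "Modules.additive l" and "f \<noteq> 0"
  shows weight_power: "weight l (f ^ k) = int k * weight l f"
    and top_part_power: "top_part l (f ^ k) = top_part l f ^ k"
proof -
  have w1: "weight l (1 :: 'm \<Rightarrow>\<^sub>0 'k) = 0"
    by (rule weight_eqI[of 0]) (auto simp: additive.zero[OF l])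
  have "weight l (f ^ k) = int k * weight l f \<and> top_part l (f ^ k) = top_part l f ^ k"
  proof (induction k)
    case 0
    then show ?case
      by (auto simp: w1 additive.zero[OF l] intro!: component_self)
  next
    case (Suc k)
    then show ?case
      using weight_mult[OF l assms(2), of "f ^ k"] top_part_mult[OF l assms(2), of "f ^ k"] assms(2)
      by (auto simp: algebra_simps)
  qed
  then show "weight l (f ^ k) = int k * weight l f" "top_part l (f ^ k) = top_part l f ^ k"
    by blast+
qed

section \<open>Laurent polynomial rings are completely integrally closed\<close>

locale submonoid =
  fixes T :: "'m::linordered_ab_group_add set"
  assumes zero_mem: "0 \<in> T" and add_mem: "\<And>u v. u \<in> T \<Longrightarrow> v \<in> T \<Longrightarrow> u + v \<in> T"

lemma (in submonoid) semigroup_algebra_subring: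
  "closed_subring (semigroup_algebra T :: ('m \<Rightarrow>\<^sub>0 'k::field) set)"
proof
  show "f + g \<in> semigroup_algebra T"
    if "f \<in> semigroup_algebra T" "g \<in> semigroup_algebra T" for f g :: "'m \<Rightarrow>\<^sub>0 'k"
    using that keys_add[of f g] unfolding semigroup_algebra_def by blast
  show "f * g \<in> semigroup_algebra T"
    if "f \<in> semigroup_algebra T" "g \<in> semigroup_algebra T" for f g :: "'m \<Rightarrow>\<^sub>0 'k"
    using that keys_mult[of f g] add_mem unfolding semigroup_algebra_def by fast
qed (auto simp: semigroup_algebra_def zero_mem)

text \<open>
  The algebra of \<open>L\<close> is the Laurent polynomial ring \<open>R[t, t\<^sup>-\<^sup>1]\<close> over the algebra \<open>R\<close> of the kernel of
  \<open>l\<close>, where \<open>t\<^sup>i\<close> is the monomial with exponent \<open>s i\<close>, and \<open>l\<close> measures the degree in \<open>t\<close>. Given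
  \<open>d a\<^sup>k = b\<^sup>k g\<^sub>k\<close> for all \<open>k\<close>, comparing leading coefficients shows by the hypothesis on \<open>R\<close> that the
  leading coefficient of \<open>b\<close> divides that of \<open>a\<close>, so \<open>a\<close> can be divided by \<open>b\<close> as long as its degree is
  at least that of \<open>b\<close>. If the degree of \<open>a \<noteq> 0\<close> is smaller than that of \<open>b\<close> while its order is not
  smaller, then the degree of \<open>g\<^sub>k\<close> is at most \<open>deg d - k\<close> and its order at least \<open>ord d\<close>, which is
  impossible for large \<open>k\<close>.
\<close>

lemma completely_integrally_closed_extend:
  fixes L :: "'m::linordered_ab_group_add set" and l :: "'m \<Rightarrow> int"
  assumes "submonoid L" and l: "Modules.additive l"
    and s: "Modules.additive s" "\<And>i. s i \<in> L" "\<And>i. l (s i) = i"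
    and IH: "completely_integrally_closed
          (semigroup_algebra {v \<in> L. l v = 0} :: ('m \<Rightarrow>\<^sub>0 'k::field) set)"
  shows "completely_integrally_closed (semigroup_algebra L :: ('m \<Rightarrow>\<^sub>0 'k) set)"
  unfolding completely_integrally_closed_def
proof (intro ballI impI)
  define A :: "('m \<Rightarrow>\<^sub>0 'k) set" where "A = semigroup_algebra L"
  define A0 :: "('m \<Rightarrow>\<^sub>0 'k) set" where "A0 = semigroup_algebra {v \<in> L. l v = 0}"
  interpret L: submonoid L by fact
  interpret A: closed_subring A
    unfolding A_def by (rule L.semigroup_algebra_subring)
  have A0_A: "A0 \<subseteq> A"
    by (auto simp: A_def A0_def semigroup_algebra_def)
  define t :: "int \<Rightarrow> ('m \<Rightarrow>\<^sub>0 'k)" where "t i = Poly_Mapping.single (s i) 1" for i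
  have t_mem: "t i \<in> A" for i
    by (simp add: t_def A_def semigroup_algebra_def s)
  have t_add: "t (i + j) = t i * t j" for i j
    by (simp add: t_def mult_single additive.add[OF s(1)])
  have t_0: "t 0 = 1"
    by (simp add: t_def additive.zero[OF s(1)])
  have t_power: "t i ^ k = t (int k * i)" for i k
    by (induction k) (auto simp: t_0 t_add algebra_simps)
  have keys_t_mult: "keys (t i * f) \<subseteq> {s i + v | v. v \<in> keys f}"
    for i and f :: "'m \<Rightarrow>\<^sub>0 'k"
    using keys_mult[of "t i" f] by (auto simp: t_def)
  \<comment> \<open>Leading coefficients with respect to \<open>l\<close>, as elements of the smaller algebra.\<close>
  define lc where "lc f = t (- weight l f) * top_part l f" for f :: "'m \<Rightarrow>\<^sub>0 'k"
  have lc_mem: "lc f \<in> A0" if "f \<in> A" for f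
  proof -
    have "v \<in> L \<and> l v = 0" if "v \<in> keys (lc f)" for v
    proof -
      obtain u where "v = s (- weight l f) + u" "u \<in> keys f" "l u = weight l f"
        using \<open>v \<in> keys (lc f)\<close> keys_t_mult[of "- weight l f" "top_part l f"]
        by (auto simp: lc_def keys_component)
      moreover have "u \<in> L"
        using \<open>f \<in> A\<close> \<open>u \<in> keys f\<close> by (auto simp: A_def semigroup_algebra_def)
      ultimately show ?thesis
        using L.add_mem[OF s(2)] by (simp add: additive.add[OF l] s(3))
    qed
    then show ?thesis
      by (auto simp: A0_def semigroup_algebra_def)
  qed
  have top_lc: "top_part l f = t (weight l f) * lc f" for f
    using t_add[of "weight l f" "- weight l f"] t_0 by (simp add: lc_def mult.assoc[symmetric])
  have lc_nonzero: "lc f \<noteq> 0" if "f \<noteq> 0" for f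
    using top_part_nonzero[OF that, of l] by (auto simp: top_lc)
  fix a b d :: "'m \<Rightarrow>\<^sub>0 'k"
  assume "a \<in> semigroup_algebra L" "b \<in> semigroup_algebra L" "d \<in> semigroup_algebra L"
    "bounded_denominator (semigroup_algebra L) d a b" and nz: "b \<noteq> 0" "d \<noteq> 0"
  then have mem: "a \<in> A" "b \<in> A" "d \<in> A" and bd: "bounded_denominator A d a b"
    by (auto simp: A_def)
  define m where "m f = - weight (\<lambda>v. - l v) f" for f :: "'m \<Rightarrow>\<^sub>0 'k"
  have l': "Modules.additive (\<lambda>v. - l v)"
    by standard (simp add: additive.add[OF l])
  have m_le: "m f \<le> l v" if "v \<in> keys f" for f v
    using le_weight[OF that, of "\<lambda>v. - l v"] by (simp add: m_def)
  \<comment> \<open>The division algorithm, by induction on a bound \<open>N\<close> for the excess of the degree of \<open>a\<close> over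
    that of \<open>b\<close>. Keeping the order of \<open>a\<close> at least \<open>m b\<close> forces the final remainder to vanish.\<close>
  have divides: "\<exists>q\<in>A. a = b * q"
    if "a \<in> A" "\<And>v. v \<in> keys a \<Longrightarrow> m b \<le> l v" "bounded_denominator A d a b"
      "a = 0 \<or> weight l a < weight l b + int N" for a N
    using that
  proof (induction N arbitrary: a)
    case 0
    have "a = 0"
    proof (rule ccontr)
      assume a: "a \<noteq> 0"
      \<comment> \<open>From this \<open>k\<close> on, the degree of \<open>d (a/b)\<^sup>k\<close> falls below its order.\<close>
      define k where "k = nat (weight l d - m d + 1)"
      obtain g where g: "g \<in> A" "d * a ^ k = b ^ k * g"
        using 0 unfolding bounded_denominator_def by blast
      have g0: "g \<noteq> 0"
        using g(2) a nz by auto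
      have "weight l d + int k * weight l a = int k * weight l b + weight l g"
        using arg_cong[OF g(2), of "weight l"] a nz g0
        by (simp add: weight_mult[OF l] weight_power[OF l])
      moreover have "m d + int k * m a = int k * m b + m g"
        using arg_cong[OF g(2), of m] a nz g0
        by (simp add: m_def weight_mult[OF l'] weight_power[OF l'] algebra_simps)
      moreover have "m b \<le> m a"
        using weight_attained[OF a, of "\<lambda>v. - l v"] 0(2) by (force simp: m_def)
      moreover have "m g \<le> weight l g"
        using weight_attained[OF g0, of l] m_le by force
      moreover have "weight l a + 1 \<le> weight l b"
        using 0 a by auto
      moreover have "int k * (weight l a + 1) \<le> int k * weight l b"
        by (intro mult_left_mono) (use \<open>weight l a + 1 \<le> weight l b\<close> in auto)
      moreover have "int k * m b \<le> int k * m a"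
        by (intro mult_left_mono) (use \<open>m b \<le> m a\<close> in auto)
      moreover have "int k > weight l d - m d"
        by (simp add: k_def)
      ultimately show False
        by (simp add: algebra_simps)
    qed
    then show ?case
      by (auto intro: A.zero_mem)
  next
    case (Suc N)
    show ?case
    proof (cases "a = 0 \<or> weight l a < weight l b + int N")
      case True
      then show ?thesis
        using Suc by blast
    next
      case False
      then have a: "a \<noteq> 0" and wa: "weight l a = weight l b + int N"
        using Suc.prems by auto
      have "bounded_denominator A0 (lc d) (lc a) (lc b)"
        unfolding bounded_denominator_def
      proof
        fix k
        obtain g where g: "g \<in> A" "d * a ^ k = b ^ k * g"
          using Suc.prems unfolding bounded_denominator_def by blast
        have g0: "g \<noteq> 0"
          using g(2) a nz by auto
        have "weight l d + int k * weight l a = int k * weight l b + weight l g"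
          using arg_cong[OF g(2), of "weight l"] a nz g0
          by (simp add: weight_mult[OF l] weight_power[OF l])
        then have w: "- weight l d + int k * - weight l a = int k * - weight l b + - weight l g"
          by simp
        have tp: "top_part l d * top_part l a ^ k = top_part l b ^ k * top_part l g"
          using arg_cong[OF g(2), of "top_part l"] a nz g0
          by (simp add: top_part_mult[OF l] top_part_power[OF l])
        have "lc d * lc a ^ k
            = (t (- weight l d) * t (int k * - weight l a)) * (top_part l d * top_part l a ^ k)"
          by (simp add: lc_def power_mult_distrib t_power mult_ac)
        also have "\<dots> = (t (int k * - weight l b) * t (- weight l g))
            * (top_part l b ^ k * top_part l g)"
          by (simp only: t_add[symmetric] w tp)
        also have "\<dots> = lc b ^ k * lc g"
          by (simp add: lc_def power_mult_distrib t_power mult_ac)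
        finally show "\<exists>g\<in>A0. lc d * lc a ^ k = lc b ^ k * g"
          using lc_mem[OF g(1)] by blast
      qed
      then obtain q where q: "q \<in> A0" "lc a = lc b * q"
        using IH[unfolded completely_integrally_closed_def, folded A0_def, rule_format,
            OF lc_mem[OF Suc.prems(1)] lc_mem[OF mem(2)] lc_mem[OF mem(3)]
              lc_nonzero[OF nz(1)] lc_nonzero[OF nz(2)]]
        by blast
      \<comment> \<open>The leading term of the quotient.\<close>
      define q' where "q' = t (int N) * q"
      have q'_mem: "q' \<in> A"
        using q(1) A0_A t_mem by (auto simp: q'_def intro: A.mult_mem)
      have keys_q': "l v = int N" if v: "v \<in> keys q'" for v
      proof -
        obtain u where "v = s (int N) + u" "u \<in> keys q"
          using v keys_t_mult[of "int N" q] unfolding q'_def by auto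
        then show ?thesis
          using q(1) by (auto simp: A0_def semigroup_algebra_def additive.add[OF l] s(3))
      qed
      have keys_bq': "\<exists>u\<in>keys b. l v = l u + int N" if "v \<in> keys (b * q')" for v
        using that keys_q' by (elim keys_mult_additive[OF l]) auto
      have top: "component l (weight l a) (b * q') = top_part l a"
      proof -
        have "component l (weight l a) (b * q') = top_part l b * component l (int N) q'"
          unfolding wa by (intro component_mult l le_weight) (simp_all add: keys_q')
        also have "component l (int N) q' = q'"
          by (intro component_self keys_q')
        also have "top_part l b * q' = (t (weight l b) * t (int N)) * (lc b * q)"
          by (simp only: top_lc[of b] q'_def mult_ac)
        also have "\<dots> = t (weight l a) * lc a"
          by (simp only: wa t_add q(2))
        also have "\<dots> = top_part l a"
          by (simp only: top_lc)
        finally show ?thesis .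
      qed
      define a1 where "a1 = a - b * q'"
      have keys_a1: "l v < weight l a" "m b \<le> l v" if v: "v \<in> keys a1" for v
      proof -
        have *: "v \<in> keys a \<or> v \<in> keys (b * q')"
          using v keys_diff[of a "b * q'"] by (auto simp: a1_def)
        then show "m b \<le> l v"
          using Suc.prems(2) keys_bq'[of v] m_le[of _ b] by force
        have "l v \<le> weight l a"
          using * keys_bq'[of v] le_weight[of _ b l] le_weight[of v a l] wa by force
        moreover have "l v \<noteq> weight l a"
        proof
          assume "l v = weight l a"
          then have "lookup a v = lookup (b * q') v"
            using arg_cong[OF top, of "\<lambda>f. lookup f v"] by (simp add: lookup_component)
          then show False
            using v by (simp add: a1_def in_keys_iff lookup_minus)
        qed
        ultimately show "l v < weight l a"
          by simp
      qed
      have "\<exists>q\<in>A. a1 = b * q"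
      proof (rule Suc.IH)
        show "a1 \<in> A"
          unfolding a1_def using Suc.prems(1) mem q'_mem by (blast intro: A.diff_mem A.mult_mem)
        show "bounded_denominator A d a1 b"
          unfolding a1_def using Suc.prems(3) q'_mem by (rule A.bounded_denominator_diff)
        show "a1 = 0 \<or> weight l a1 < weight l b + int N"
          using weight_attained[of a1 l] keys_a1(1) wa by force
      qed (rule keys_a1)
      then obtain q1 where "q1 \<in> A" "a1 = b * q1"
        by blast
      then have "q1 + q' \<in> A" "a = b * (q1 + q')"
        using q'_mem by (auto simp: a1_def algebra_simps intro: A.add_mem)
      then show ?thesis
        by blast
    qed
  qed
  \<comment> \<open>Multiplying \<open>a\<close> by a power of the unit \<open>t 1\<close> moves its support above the bottom of \<open>b\<close>.\<close>
  define i where "i = m b - m a"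
  have "\<exists>q\<in>A. t i * a = b * q"
  proof (rule divides[where N = "nat (weight l (t i * a) - weight l b + 1)"])
    show "t i * a \<in> A"
      using t_mem mem by (blast intro: A.mult_mem)
    show "bounded_denominator A d (t i * a) b"
      using bd t_mem by (rule A.bounded_denominator_mult)
    show "m b \<le> l v" if v: "v \<in> keys (t i * a)" for v
      
    proof -
      obtain u where "v = s i + u" "u \<in> keys a"
        using v keys_t_mult[of i a] by auto
      then show ?thesis
        using m_le[of u a] by (simp add: i_def additive.add[OF l] s(3))
    qed
    show "t i * a = 0 \<or> weight l (t i * a) < weight l b + int (nat (weight l (t i * a) - weight l b + 1))"
      by linarith
  qed
  then obtain q where "q \<in> A" "t i * a = b * q"
    by blast
  have "a = (t (- i) * t i) * a"
    using t_add[of "- i" i] by (simp add: t_0)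
  also have "\<dots> = b * (t (- i) * q)"
    unfolding mult.assoc \<open>t i * a = b * q\<close> by (rule mult.left_commute)
  finally have "a = b * (t (- i) * q)" .
  then show "\<exists>q\<in>semigroup_algebra L. a = b * q"
    using \<open>q \<in> A\<close> t_mem A.mult_mem unfolding A_def by blast
qed

definition lattice :: "nat \<Rightarrow> (nat \<Rightarrow>\<^sub>0 int) set" where
  "lattice n = {v. keys v \<subseteq> {..<n}}"

lemma submonoid_lattice: "submonoid (lattice n)"
proof
  show "u + v \<in> lattice n" if "u \<in> lattice n" "v \<in> lattice n" for u v
    using that keys_add[of u v] by (auto simp: lattice_def)
qed (simp add: lattice_def)

lemma completely_integrally_closed_laurent:
  "completely_integrally_closed (semigroup_algebra (lattice n) :: ((nat \<Rightarrow>\<^sub>0 int) \<Rightarrow>\<^sub>0 'k::field) set)"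
proof (induction n)
  case 0
  show ?case
    unfolding completely_integrally_closed_def
  proof (intro ballI impI)
    fix a b :: "(nat \<Rightarrow>\<^sub>0 int) \<Rightarrow>\<^sub>0 'k"
    assume a: "a \<in> semigroup_algebra (lattice 0)" and b: "b \<in> semigroup_algebra (lattice 0)" "b \<noteq> 0"
    have const: "f = Poly_Mapping.single 0 (lookup f 0)"
      if "f \<in> semigroup_algebra (lattice 0)" for f :: "(nat \<Rightarrow>\<^sub>0 int) \<Rightarrow>\<^sub>0 'k"
      using that by (intro poly_mapping_eqI)
        (auto simp: semigroup_algebra_def lattice_def lookup_single when_def in_keys_iff)
    define q :: "(nat \<Rightarrow>\<^sub>0 int) \<Rightarrow>\<^sub>0 'k" where
      "q = Poly_Mapping.single 0 (lookup a 0 / lookup b 0)"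
    have "lookup b 0 \<noteq> 0"
      using const[OF b(1)] b(2) by (metis single_zero)
    then have "a = b * q"
      by (subst const[OF a], subst const[OF b(1)]) (simp add: q_def mult_single)
    moreover have "q \<in> semigroup_algebra (lattice 0)"
      by (auto simp: q_def semigroup_algebra_def lattice_def)
    ultimately show "\<exists>q\<in>semigroup_algebra (lattice 0). a = b * q"
      by blast
  qed
next
  case (Suc n)
  have "lattice n = {v \<in> lattice (Suc n). lookup v n = 0}"
    by (auto simp: lattice_def in_keys_iff less_Suc_eq)
  with Suc.IH have "completely_integrally_closed (semigroup_algebra
      {v \<in> lattice (Suc n). lookup v n = 0} :: ((nat \<Rightarrow>\<^sub>0 int) \<Rightarrow>\<^sub>0 'k) set)"
    by simp
  then show ?case
  proof (rule completely_integrally_closed_extend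
      [where l = "\<lambda>v. lookup v n" and s = "Poly_Mapping.single n", rotated -1])
    show "Modules.additive (\<lambda>v :: nat \<Rightarrow>\<^sub>0 int. lookup v n)"
      by standard (simp add: lookup_add)
    show "Modules.additive (Poly_Mapping.single n :: int \<Rightarrow> nat \<Rightarrow>\<^sub>0 int)"
      by standard (simp add: single_add)
  qed (use submonoid_lattice in \<open>auto simp: lattice_def\<close>)
qed

section \<open>Saturated and unsaturated semigroups\<close>

text \<open>
  An integral quotient is an element \<open>q\<close> of the algebra of \<open>L\<close>, and \<open>d q\<^sup>k\<close> is supported where the
  functionals are nonnegative, for every \<open>k\<close>. Since the least value of a functional on a support is
  additive on products, it cannot be negative for \<open>q\<close>.
\<close>

lemma normal_of_inequalities:
  fixes L :: "'m::linordered_ab_group_add set" and \<Lambda> :: "('m \<Rightarrow> int) set"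
  assumes "submonoid L" and \<Lambda>: "\<And>l. l \<in> \<Lambda> \<Longrightarrow> Modules.additive l"
    and closed: "completely_integrally_closed (semigroup_algebra L :: ('m \<Rightarrow>\<^sub>0 'k::field) set)"
  shows "normal_subring
    (semigroup_algebra {v \<in> L. \<forall>l\<in>\<Lambda>. 0 \<le> l v} :: ('m \<Rightarrow>\<^sub>0 'k) set)"
  unfolding normal_subring_def
proof (intro ballI impI)
  define S where "S = {v \<in> L. \<forall>l\<in>\<Lambda>. 0 \<le> l v}"
  define A :: "('m \<Rightarrow>\<^sub>0 'k) set" where "A = semigroup_algebra S"
  interpret L: submonoid L by fact
  interpret S: submonoid S
    by standard (auto simp: S_def L.zero_mem L.add_mem additive.zero[OF \<Lambda>] additive.add[OF \<Lambda>])
  interpret A: closed_subring A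
    unfolding A_def by (rule S.semigroup_algebra_subring)
  have A_L: "A \<subseteq> semigroup_algebra L"
    by (auto simp: A_def S_def semigroup_algebra_def)
  fix x :: "('m \<Rightarrow>\<^sub>0 'k) fract"
  assume "x \<in> field_of_fractions (semigroup_algebra {v \<in> L. \<forall>l\<in>\<Lambda>. 0 \<le> l v})"
    and int: "integral_over (fraction_embedding (semigroup_algebra {v \<in> L. \<forall>l\<in>\<Lambda>. 0 \<le> l v})) x"
  then obtain a b where x: "x = Fract a b" and ab: "a \<in> A" "b \<in> A" "b \<noteq> 0"
    unfolding field_of_fractions_def A_def S_def by blast
  obtain d where d: "d \<in> A" "d \<noteq> 0" "bounded_denominator A d a b"
    using A.integral_imp_bounded_denominator[OF ab] int unfolding x A_def S_def by blast
  have "bounded_denominator (semigroup_algebra L) d a b"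
    using d(3) A_L unfolding bounded_denominator_def by blast
  then obtain q where q: "q \<in> semigroup_algebra L" "a = b * q"
    using closed ab d A_L unfolding completely_integrally_closed_def by blast
  have dq: "d * q ^ k \<in> A" for k
  proof -
    obtain g where "g \<in> A" "d * a ^ k = b ^ k * g"
      using d(3) unfolding bounded_denominator_def by blast
    then have "b ^ k * (d * q ^ k) = b ^ k * g"
      by (simp add: q(2) power_mult_distrib mult_ac)
    with ab(3) \<open>g \<in> A\<close> show ?thesis
      by simp
  qed
  have "0 \<le> l v" if "l \<in> \<Lambda>" "v \<in> keys q" for l v
  proof (rule ccontr)
    assume neg: "\<not> 0 \<le> l v"
    define w where "w = (weight (\<lambda>v. - l v) :: ('m \<Rightarrow>\<^sub>0 'k) \<Rightarrow> int)"
    have l': "Modules.additive (\<lambda>v. - l v)"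
      by standard (simp add: additive.add[OF \<Lambda>[OF that(1)]])
    have q0: "q \<noteq> 0"
      using that(2) by auto
    have wq: "1 \<le> w q"
      using le_weight[OF that(2), of "\<lambda>v. - l v"] neg by (simp add: w_def)
    \<comment> \<open>Enough factors \<open>q\<close> to outweigh the contribution of \<open>d\<close>.\<close>
    define k where "k = nat (1 - w d)"
    have "d * q ^ k \<noteq> 0"
      using d q0 by simp
    then obtain u where "u \<in> keys (d * q ^ k)" "- l u = w (d * q ^ k)"
      using weight_attained[of "d * q ^ k" "\<lambda>v. - l v"] unfolding w_def by blast
    moreover have "0 \<le> l u" if "u \<in> keys (d * q ^ k)" for u
      using that dq[of k] \<open>l \<in> \<Lambda>\<close> by (auto simp: A_def S_def semigroup_algebra_def)
    ultimately have "w (d * q ^ k) \<le> 0"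
      by force
    moreover have "w (d * q ^ k) = w d + int k * w q"
      using d q0 unfolding w_def by (simp add: weight_mult[OF l'] weight_power[OF l'])
    moreover have "int k * 1 \<le> int k * w q"
      by (intro mult_left_mono wq) simp
    moreover have "int k \<ge> 1 - w d"
      by (simp add: k_def)
    ultimately show False
      by linarith
  qed
  then have "q \<in> A"
    using q(1) by (auto simp: A_def S_def semigroup_algebra_def)
  moreover have "x = Fract q 1"
    using ab(3) by (simp add: x q(2) eq_fract)
  ultimately show "x \<in> fraction_embedding (semigroup_algebra {v \<in> L. \<forall>l\<in>\<Lambda>. 0 \<le> l v})"
    unfolding fraction_embedding_def A_def S_def by blast
qed

text \<open>
  The monomial \<open>X\<^sup>v\<close> is the quotient of \<open>X\<^bsup>v+w\<^esup>\<close> by \<open>X\<^sup>w\<close> and a root of \<open>T\<^sup>2 - X\<^bsup>2v\<^esup>\<close>.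
\<close>

lemma not_normal_if_not_saturated:
  fixes S :: "'m::linordered_ab_group_add set"
  assumes "v \<notin> S" "v + v \<in> S" "w \<in> S" "v + w \<in> S" "submonoid S"
  shows "\<not> normal_subring (semigroup_algebra S :: ('m \<Rightarrow>\<^sub>0 'k::field) set)"
proof
  define A :: "('m \<Rightarrow>\<^sub>0 'k) set" where "A = semigroup_algebra S"
  interpret S: submonoid S by fact
  interpret A: closed_subring A
    unfolding A_def by (rule S.semigroup_algebra_subring)
  interpret E: closed_subring "fraction_embedding A"
    by (rule A.fraction_embedding_closed)
  define X :: "'m \<Rightarrow> ('m \<Rightarrow>\<^sub>0 'k)" where "X u = Poly_Mapping.single u 1" for u
  have X_mem: "X u \<in> A \<longleftrightarrow> u \<in> S" for u
    by (simp add: X_def A_def semigroup_algebra_def)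
  have X_add: "X (u + u') = X u * X u'" for u u'
    by (simp add: X_def mult_single)
  have X_nonzero: "X u \<noteq> 0" for u
    unfolding X_def by (metis lookup_single_eq lookup_zero zero_neq_one)
  define x where "x = Fract (X v) 1"
  have "x = Fract (X (v + w)) (X w)"
    by (simp add: x_def eq_fract X_add X_nonzero)
  then have "x \<in> field_of_fractions A"
    unfolding field_of_fractions_def using assms X_mem X_nonzero by blast
  moreover have "integral_over (fraction_embedding A) x"
    unfolding integral_over_def
  proof (intro exI conjI allI)
    define c where "c = Fract (X (v + v)) 1"
    have "c \<in> fraction_embedding A"
      unfolding fraction_embedding_def c_def using assms X_mem by blast
    then show "coeff [:- c, 0, 1:] i \<in> fraction_embedding A" for i
      by (auto simp: coeff_pCons split: nat.split
          intro: E.uminus_mem E.zero_mem E.one_mem)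
    show "lead_coeff [:- c, 0, 1:] = 1"
      by simp
    show "poly [:- c, 0, 1:] x = 0"
      by (simp add: c_def x_def X_add fract_collapse)
  qed
  moreover assume "normal_subring (semigroup_algebra S :: ('m \<Rightarrow>\<^sub>0 'k) set)"
  ultimately have "x \<in> fraction_embedding A"
    unfolding normal_subring_def A_def by blast
  then have "X v \<in> A"
    by (auto simp: fraction_embedding_def x_def eq_fract)
  with assms(1) show False
    by (simp add: X_mem)
qed

section \<open>The semigroups of the matrices\<close>

lemma submonoid_generated: "submonoid (generated_monoid G)"
  by standard (auto intro: generated_monoid.intros)

abbreviation column :: "nat \<Rightarrow> int \<Rightarrow> (nat \<Rightarrow>\<^sub>0 int)" where
  "column j i \<equiv> Poly_Mapping.single 0 1 + Poly_Mapping.single j i"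

lemma column_mem:
  assumes "1 \<le> j" "j \<le> length ns" "1 \<le> i" "i \<le> int (ns ! (j - 1))"
  shows "column j i \<in> generated_monoid (H_columns ns)"
proof (rule generated_monoid.base)
  have "column j i = column j (int (nat i))" "1 \<le> nat i" "nat i \<le> ns ! (j - 1)"
    using assms by auto
  with assms(1,2) show "column j i \<in> H_columns ns"
    unfolding H_columns_def by blast
qed

text \<open>
  When the blocks \<open>j \<ge> 2\<close> have a single column each, a sum of columns equal to \<open>v\<close> uses \<open>v\<^sub>j\<close> copies of
  the column of block \<open>j \<ge> 2\<close>, and this number counts its columns from the first block.
\<close>

definition first_block_degree :: "nat \<Rightarrow> (nat \<Rightarrow>\<^sub>0 int) \<Rightarrow> int" where
  "first_block_degree c v = lookup v 0 - (\<Sum>j\<in>{2..c}. lookup v j)"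

definition cone_functionals :: "nat list \<Rightarrow> ((nat \<Rightarrow>\<^sub>0 int) \<Rightarrow> int) set" where
  "cone_functionals ns =
     {\<lambda>v. lookup v j | j. 2 \<le> j \<and> j \<le> length ns} \<union>
     {first_block_degree (length ns),
      \<lambda>v. lookup v 1 - first_block_degree (length ns) v,
      \<lambda>v. int (ns ! 0) * first_block_degree (length ns) v - lookup v 1}"

lemma additive_first_block_degree: "Modules.additive (first_block_degree c)"
  by standard (simp add: first_block_degree_def lookup_add sum.distrib)

lemma additive_cone_functionals: "l \<in> cone_functionals ns \<Longrightarrow> Modules.additive l"
  by (auto simp: cone_functionals_def Modules.additive_def lookup_add algebra_simps
      additive.add[OF additive_first_block_degree])

lemma first_block_degree_column:
  assumes "1 \<le> j" "j \<le> c"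
  shows "first_block_degree c (column j i) = 1 - (if 2 \<le> j then i else 0)"
proof -
  have "(\<Sum>k\<in>{2..c}. lookup (column j i) k) = (\<Sum>k\<in>{2..c}. if k = j then i else 0)"
    by (intro sum.cong) (auto simp: lookup_add lookup_one lookup_single when_def)
  then show ?thesis
    using assms by (auto simp: first_block_degree_def lookup_add lookup_one lookup_single)
qed

text \<open>
  A point of the cone is written as a sum of columns by peeling off one column at a time, which
  lowers the first coordinate by 1: a column of a block \<open>j \<ge> 2\<close> as long as \<open>v\<^sub>j > 0\<close>, and afterwards a
  column of the first block.
\<close>

lemma generated_monoid_eq_cone:
  assumes c: "length ns \<ge> 1" and n1: "ns ! 0 \<ge> 1"
    and ones: "\<And>j. 1 \<le> j \<Longrightarrow> j < length ns \<Longrightarrow> ns ! j = 1"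
  shows "generated_monoid (H_columns ns)
      = {v \<in> lattice (Suc (length ns)). \<forall>l\<in>cone_functionals ns. 0 \<le> l v}"
    (is "?S = ?C")
proof
  let ?p = "first_block_degree (length ns)"
  interpret L: submonoid "lattice (Suc (length ns))"
    by (rule submonoid_lattice)
  show "?S \<subseteq> ?C"
  proof
    fix v assume "v \<in> ?S"
    then show "v \<in> ?C"
    proof induction
      case zero
      then show ?case
        by (simp add: L.zero_mem additive.zero[OF additive_cone_functionals])
    next
      case (base g)
      then obtain j i where g: "g = column j (int i)"
        and j: "1 \<le> j" "j \<le> length ns" and i: "1 \<le> i" "i \<le> ns ! (j - 1)"
        unfolding H_columns_def by blast
      have "i = 1" if "2 \<le> j"
        using ones[of "j - 1"] that i j by auto
      then have p: "?p g = (if 2 \<le> j then 0 else 1)"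
        using first_block_degree_column[OF j] by (simp add: g)
      have "g \<in> lattice (Suc (length ns))"
        unfolding g using j by (intro L.add_mem) (auto simp: lattice_def)
      moreover have "0 \<le> l g" if "l \<in> cone_functionals ns" for l
        using that p i j unfolding cone_functionals_def
        by (cases "j = 1") (auto simp: g lookup_add lookup_one lookup_single when_def)
      ultimately show ?case
        by blast
    next
      case (add x y)
      then show ?case
        by (simp add: L.add_mem additive.add[OF additive_cone_functionals])
    qed
  qed
  have cone_mem: "v \<in> ?C \<longleftrightarrow> v \<in> lattice (Suc (length ns)) \<and>
      (\<forall>j. 2 \<le> j \<and> j \<le> length ns \<longrightarrow> 0 \<le> lookup v j) \<and>
      0 \<le> ?p v \<and> ?p v \<le> lookup v 1 \<and> lookup v 1 \<le> int (ns ! 0) * ?p v" for v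
    unfolding cone_functionals_def by auto
  have peel: "v \<in> ?S" if "v - column j i \<in> ?S" "1 \<le> j" "j \<le> length ns" "1 \<le> i" "i \<le> int (ns ! (j - 1))"
    for v j i
    using generated_monoid.add[OF that(1) column_mem[OF that(2-5)]] by simp
  have "v \<in> ?S" if "v \<in> ?C" "lookup v 0 = int k" for v k
    using that
  proof (induction k arbitrary: v)
    case 0
    then have *: "\<And>j. 2 \<le> j \<and> j \<le> length ns \<Longrightarrow> 0 \<le> lookup v j" "0 \<le> ?p v"
      "?p v \<le> lookup v 1" "lookup v 1 \<le> int (ns ! 0) * ?p v" "v \<in> lattice (Suc (length ns))"
      unfolding cone_mem by auto
    have "(\<Sum>j\<in>{2..length ns}. lookup v j) = 0"
      using *(1,2) 0 sum_nonneg[of "{2..length ns}" "lookup v"]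
      by (auto simp: first_block_degree_def)
    then have "lookup v j = 0" if "2 \<le> j" "j \<le> length ns" for j
      using that *(1) sum_nonneg_eq_0_iff[of "{2..length ns}" "lookup v"] by auto
    moreover have "?p v = 0"
      using \<open>(\<Sum>j\<in>{2..length ns}. lookup v j) = 0\<close> 0 by (simp add: first_block_degree_def)
    moreover have "lookup v 1 = 0"
      using \<open>?p v = 0\<close> *(3,4) by simp
    moreover have "lookup v j = 0" if "j > length ns" for j
      using that *(5) by (auto simp: lattice_def in_keys_iff)
    ultimately have "lookup v j = 0" for j
      using 0(2) by (cases "j = 0"; cases "j = 1"; cases "j \<le> length ns") auto
    then have "v = 0"
      by (simp add: poly_mapping_eqI)
    then show ?case
      by (simp add: generated_monoid.zero)
  next
    case (Suc k)
    have v: "\<And>j. 2 \<le> j \<Longrightarrow> j \<le> length ns \<Longrightarrow> 0 \<le> lookup v j" "0 \<le> ?p v"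
      "?p v \<le> lookup v 1" "lookup v 1 \<le> int (ns ! 0) * ?p v" "v \<in> lattice (Suc (length ns))"
      using Suc.prems(1) unfolding cone_mem by auto
    have diff_lattice: "v - column j i \<in> lattice (Suc (length ns))" if "j \<le> length ns" for j i
    proof -
      have "column j i \<in> lattice (Suc (length ns))"
        using that by (intro L.add_mem) (auto simp: lattice_def)
      then show ?thesis
        using v(5) keys_diff[of v "column j i"] unfolding lattice_def by blast
    qed
    note diff_p = additive.diff[OF additive_first_block_degree]
    show ?case
    proof (cases "\<exists>j. 2 \<le> j \<and> j \<le> length ns \<and> 0 < lookup v j")
      case True
      then obtain j where j: "2 \<le> j" "j \<le> length ns" "0 < lookup v j"
        by blast
      have "?p (v - column j 1) = ?p v"
        using j first_block_degree_column[of j "length ns" 1] by (simp add: diff_p)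
      then have "v - column j 1 \<in> ?C"
        unfolding cone_mem using v j diff_lattice[of j 1]
        by (auto simp: lookup_minus lookup_add lookup_one lookup_single when_def)
      moreover have "lookup (v - column j 1) 0 = int k"
        using Suc.prems(2) j by (simp add: lookup_minus lookup_add lookup_one lookup_single)
      ultimately have "v - column j 1 \<in> ?S"
        by (rule Suc.IH)
      then show ?thesis
        using j ones[of "j - 1"] by (intro peel[of v j 1]) auto
    next
      case False
      then have zero: "lookup v j = 0" if "2 \<le> j" "j \<le> length ns" for j
        using v(1)[OF that] that by force
      have p: "?p v = int k + 1"
        using zero Suc.prems(2) by (simp add: first_block_degree_def)
      \<comment> \<open>The largest admissible column that leaves at least 1 for each of the \<open>k\<close> others.\<close>
      define i where "i = min (int (ns ! 0)) (lookup v 1 - int k)"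
      have i: "1 \<le> i" "i \<le> int (ns ! 0)"
        using v(3) p n1 by (auto simp: i_def)
      have bound: "int k \<le> lookup v 1 - i" "lookup v 1 - i \<le> int (ns ! 0) * int k"
      proof -
        show "int k \<le> lookup v 1 - i"
          by (simp add: i_def)
        have "1 * int k \<le> int (ns ! 0) * int k"
          using n1 by (intro mult_right_mono) auto
        then show "lookup v 1 - i \<le> int (ns ! 0) * int k"
          using v(4) p by (auto simp: i_def min_def algebra_simps)
      qed
      have "?p (v - column 1 i) = int k"
        using c p first_block_degree_column[of 1 "length ns" i] by (simp add: diff_p)
      then have "v - column 1 i \<in> ?C"
        unfolding cone_mem using bound zero diff_lattice[of 1 i] c
        by (auto simp: lookup_minus lookup_add lookup_one lookup_single when_def)
      moreover have "lookup (v - column 1 i) 0 = int k"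
        using Suc.prems(2) by (simp add: lookup_minus lookup_add lookup_one lookup_single)
      ultimately have "v - column 1 i \<in> ?S"
        by (rule Suc.IH)
      then show ?thesis
        using i c by (intro peel[of v 1 i]) auto
    qed
  qed
  note graded = this
  show "?C \<subseteq> ?S"
  proof
    fix v assume v: "v \<in> ?C"
    then have "0 \<le> (\<Sum>j\<in>{2..length ns}. lookup v j)" "0 \<le> ?p v"
      unfolding cone_mem by (auto intro: sum_nonneg)
    then have "0 \<le> lookup v 0"
      by (simp add: first_block_degree_def)
    then show "v \<in> ?S"
      using graded[OF v, of "nat (lookup v 0)"] by simp
  qed
qed

lemma generated_monoid_first_coordinate:
  assumes "v \<in> generated_monoid (H_columns ns)"
  shows "v = 0 \<or> v \<in> H_columns ns \<or> lookup v 0 \<ge> 2"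
proof -
  have column: "lookup g 0 = 1" if "g \<in> H_columns ns" for g
    using that by (auto simp: H_columns_def lookup_add lookup_one lookup_single)
  show ?thesis
    using assms
  proof induction
    case (add x y)
    then show ?case
      using column[of x] column[of y] by (auto simp: lookup_add)
  qed auto
qed

theorem lemma2:
  fixes ns :: "nat list"
  assumes "length ns \<ge> 1"
    and "sorted_wrt (\<ge>) ns"
    and "\<forall>n \<in> set ns. n \<ge> 1"
  shows "normal_subring (H_algebra ns :: ((nat \<Rightarrow>\<^sub>0 int) \<Rightarrow>\<^sub>0 'k::field) set)
           \<longleftrightarrow> \<not> H_dominates ns [2, 2]"
proof -
  have pos: "1 \<le> ns ! j" if "j < length ns" for j
    using assms(3) that by simp
  have anti: "ns ! j \<le> ns ! i" if "i \<le> j" "j < length ns" for i j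
    using assms(2) that by (cases "i = j") (auto simp: sorted_wrt_iff_nth_less)
  have dom: "H_dominates ns [2, 2] \<longleftrightarrow> 2 \<le> length ns \<and> 2 \<le> ns ! 1"
    using anti[of 0 1] by (auto simp: H_dominates_def less_Suc_eq numeral_2_eq_2)
  show ?thesis
  proof (cases "H_dominates ns [2, 2]")
    case True
    then have n: "2 \<le> length ns" "2 \<le> ns ! 1" "2 \<le> ns ! 0"
      using dom anti[of 0 1] by auto
    define v :: "nat \<Rightarrow>\<^sub>0 int" where "v = column 1 1 + Poly_Mapping.single 2 1"
    have mem: "column 1 1 \<in> generated_monoid (H_columns ns)"
      "column 1 2 \<in> generated_monoid (H_columns ns)"
      "column 2 1 \<in> generated_monoid (H_columns ns)"
      "column 2 2 \<in> generated_monoid (H_columns ns)"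
      using n column_mem[of 1 ns 1] column_mem[of 1 ns 2] column_mem[of 2 ns 1]
        column_mem[of 2 ns 2] by simp_all
    have "\<not> normal_subring
        (semigroup_algebra (generated_monoid (H_columns ns)) :: ((nat \<Rightarrow>\<^sub>0 int) \<Rightarrow>\<^sub>0 'k) set)"
    proof (rule not_normal_if_not_saturated[where v = v and w = "column 2 1"])
      show "v \<notin> generated_monoid (H_columns ns)"
      proof
        assume "v \<in> generated_monoid (H_columns ns)"
        moreover have lookup_v: "lookup v 0 = 1" "lookup v 1 = 1" "lookup v 2 = 1"
          by (simp_all add: v_def lookup_add lookup_one lookup_single)
        ultimately have "v \<in> H_columns ns"
          using generated_monoid_first_coordinate[of v ns] by auto
        then show False
          using lookup_v(2,3)
          by (auto simp: H_columns_def lookup_add lookup_one lookup_single when_def split: if_splits)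
      qed
      have "v + v = column 1 2 + column 2 2"
        by (rule poly_mapping_eqI, simp only: v_def lookup_add)
          (auto simp: lookup_one lookup_single when_def)
      then show "v + v \<in> generated_monoid (H_columns ns)"
        by (simp only: generated_monoid.add mem)
      have "v + column 2 1 = column 1 1 + column 2 2"
        by (rule poly_mapping_eqI, simp only: v_def lookup_add)
          (auto simp: lookup_one lookup_single when_def)
      then show "v + column 2 1 \<in> generated_monoid (H_columns ns)"
        by (simp only: generated_monoid.add mem)
    qed (fact mem submonoid_generated)+
    with True show ?thesis
      by (simp add: H_algebra_def)
  next
    case False
    have ones: "ns ! j = 1" if "1 \<le> j" "j < length ns" for j
      using False dom pos[of j] anti[of 1 j] that by force
    have "1 \<le> ns ! 0"
      using assms(1) pos[of 0] by (cases ns) auto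
    with assms(1) have eq_cone: "generated_monoid (H_columns ns)
        = {v \<in> lattice (Suc (length ns)). \<forall>l\<in>cone_functionals ns. 0 \<le> l v}"
      using ones by (rule generated_monoid_eq_cone)
    have "normal_subring (H_algebra ns :: ((nat \<Rightarrow>\<^sub>0 int) \<Rightarrow>\<^sub>0 'k) set)"
      unfolding H_algebra_def eq_cone
      by (intro normal_of_inequalities submonoid_lattice additive_cone_functionals
          completely_integrally_closed_laurent)
    with False show ?thesis
      by simp
  qed
qed

end
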